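(* Let $l\ge 1$ be an integer and let $(p_n)_{n\ge 0}$ be the sequence of $l$-numbers. Let $q$ be a prime number and let $d$ be the first positive integer such that $q\mid p_d$. 1) For $n\in\mathbb{N}$, $q\mid p_n$ if and only if $d\mid n$. 2) Suppose $q$ is odd. If $t\ge 2$, $\gcd(q,S_t)=1$ and $d$ is an even number, then all $l$-elements $P_n$ with $n\ge d$ of the algebra $A_t=\left(\frac{-1,\ldots,-1}{\mathbb{Z}_q}\right)$ are invertible. 3) Suppose $q$ is odd. If $t\in\{2,3\}$, $\gcd(q,S_t)=1$ and $d$ is an odd number such that $d\mid(2^t-1)$, then there are no idempotent $l$-elements in the algebra $A_t=\left(\frac{-1,\ldots,-1}{\mathbb{Z}_q}\right)$; that is, no $P_n$, $n\in\mathbb{N}$, is idempotent.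
   Context: Sequence of $l$-numbers: for an integer $l\ge 1$, $p_0=0$, $p_1=1$, $p_n=l\,p_{n-1}+p_{n-2}$ for $n\ge 2$. Here $\mathbb{N}=\{0,1,2,\ldots\}$. Integers are viewed in $\mathbb{Z}_q$ (the field with $q$ elements) by reduction mod $q$. Numbers $M_k$ and $S_t$: $M_2=l^2+2$, $M_{k+1}=M_k^2-2$ for $k\ge 2$; $S_1=1$ and $S_t=M_2M_3\cdots M_t$ for $t\ge 2$. Cayley-Dickson process: let $K$ be a field of characteristic $\ne 2$. Let $A$ be a finite-dimensional unital $K$-algebra (not necessarily associative) with a scalar involution $a\mapsto\overline a$, i.e. a linear map with $\overline{ab}=\overline b\,\overline a$, $\overline{\overline a}=a$ and $a+\overline a,\ a\overline a\in K\cdot 1$. For nonzero $\gamma\in K$, the algebra $(A,\gamma)$ is the vector space $A\oplus A$ with multiplication $(a_1,a_2)(b_1,b_2)=(a_1b_1+\gamma\overline{b_2}a_2,\ a_2\overline{b_1}+b_2a_1)$ and scalar involution $\overline{(a_1,a_2)}=(\overline{a_1},-a_2)$. Starting from $A_0=K$ (with the identity involution) and applying the process successively with nonzero $\gamma_1,\ldots,\gamma_t\in K$ gives $A_t=(A_{t-1},\gamma_t)=\left(\frac{\gamma_1,\ldots,\gamma_t}{K}\right)$ of dimension $2^t$ over $K$. In $\left(\frac{-1,\ldots,-1}{\mathbb{Z}_q}\right)$ all $t$ parameters equal $-1$ and $K=\mathbb{Z}_q$. Basis: $A_t$ has the standard basis $1=e_0,e_1,\ldots,e_{2^t-1}$ built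 inductively: for $0\le i<2^{t-1}$, $e_i$ is $(e_i,0)$ and $e_{2^{t-1}+i}$ is $(0,e_i)$, where on the right $e_i$ denotes the basis element of $A_{t-1}$. $l$-elements: for $n\in\mathbb{N}$, the $n$-th $l$-element of $A_t$ is $P_n=p_n\cdot 1+p_{n+1}e_1+p_{n+2}e_2+\cdots+p_{n+2^t-1}e_{2^t-1}$. An element $x\in A_t$ is invertible if there is $y\in A_t$ with $xy=yx=1$. An idempotent element is an element $x$ with $x\ne 0$, $x\ne 1$ and $x^2=x$. *)

theory Defs
  imports "HOL-Number_Theory.Residues" "HOL-Algebra.Module"
begin

fun l_number :: "nat \<Rightarrow> nat \<Rightarrow> nat" where
  "l_number l 0 = 0"
| "l_number l (Suc 0) = 1"
| "l_number l (Suc (Suc n)) = l * l_number l (Suc n) + l_number l n"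

text \<open>Only the values for \<open>k \<ge> 2\<close> are meaningful; smaller indices get the value at 2.\<close>

fun M_number :: "nat \<Rightarrow> nat \<Rightarrow> int" where
  "M_number l k = (if k \<le> 2 then (int l)\<^sup>2 + 2 else (M_number l (k - 1))\<^sup>2 - 2)"

declare M_number.simps [simp del]

definition S_number :: "nat \<Rightarrow> nat \<Rightarrow> int" where
  "S_number l t = (\<Prod>k = 2..t. M_number l k)"

text \<open>
  The algebras \<open>A\<^sub>t\<close> have different underlying sets \<open>K\<close>, \<open>K \<times> K\<close>, \<open>\<dots>\<close>, which must live in a
  single type for \<open>A\<^sub>t\<close> to be defined by recursion on \<open>t\<close>: \<open>Scal\<close> wraps the elements of the
  ground field and \<open>Pr\<close> forms the pairs of the doubling step. The carrier of \<open>A\<^sub>t\<close> consists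
  of the full binary trees of depth \<open>t\<close>.
\<close>

datatype 'k cd = Scal (scal: 'k) | Pr (left: "'k cd") (right: "'k cd")

record ('k, 'v) inv_algebra = "('k, 'v) module" +
  invol :: "'v \<Rightarrow> 'v"

definition cd_base :: "('k, 'm) ring_scheme \<Rightarrow> ('k, 'k cd) inv_algebra" where
  "cd_base K =
    \<lparr> carrier = Scal ` carrier K,
      monoid.mult = (\<lambda>x y. Scal (scal x \<otimes>\<^bsub>K\<^esub> scal y)),
      one = Scal \<one>\<^bsub>K\<^esub>,
      zero = Scal \<zero>\<^bsub>K\<^esub>,
      add = (\<lambda>x y. Scal (scal x \<oplus>\<^bsub>K\<^esub> scal y)),
      smult = (\<lambda>c x. Scal (c \<otimes>\<^bsub>K\<^esub> scal x)),
      invol = (\<lambda>x. x) \<rparr>"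

definition cd_double :: "('k, 'k cd) inv_algebra \<Rightarrow> 'k \<Rightarrow> ('k, 'k cd) inv_algebra" where
  "cd_double A g =
    \<lparr> carrier = {Pr a b | a b. a \<in> carrier A \<and> b \<in> carrier A},
      monoid.mult = (\<lambda>x y.
        Pr (left x \<otimes>\<^bsub>A\<^esub> left y \<oplus>\<^bsub>A\<^esub> g \<odot>\<^bsub>A\<^esub> (invol A (right y) \<otimes>\<^bsub>A\<^esub> right x))
           (right x \<otimes>\<^bsub>A\<^esub> invol A (left y) \<oplus>\<^bsub>A\<^esub> right y \<otimes>\<^bsub>A\<^esub> left x)),
      one = Pr \<one>\<^bsub>A\<^esub> \<zero>\<^bsub>A\<^esub>,
      zero = Pr \<zero>\<^bsub>A\<^esub> \<zero>\<^bsub>A\<^esub>,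
      add = (\<lambda>x y. Pr (left x \<oplus>\<^bsub>A\<^esub> left y) (right x \<oplus>\<^bsub>A\<^esub> right y)),
      smult = (\<lambda>c x. Pr (c \<odot>\<^bsub>A\<^esub> left x) (c \<odot>\<^bsub>A\<^esub> right x)),
      invol = (\<lambda>x. Pr (invol A (left x)) (\<ominus>\<^bsub>A\<^esub> right x)) \<rparr>"

text \<open>The parameters are \<open>g 1, \<dots>, g t\<close>; other values of \<open>g\<close> are irrelevant.\<close>

primrec cayley_dickson ::
  "('k, 'm) ring_scheme \<Rightarrow> (nat \<Rightarrow> 'k) \<Rightarrow> nat \<Rightarrow> ('k, 'k cd) inv_algebra" where
  "cayley_dickson K g 0 = cd_base K"
| "cayley_dickson K g (Suc t) = cd_double (cayley_dickson K g t) (g (Suc t))"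

primrec cd_basis ::
  "('k, 'm) ring_scheme \<Rightarrow> (nat \<Rightarrow> 'k) \<Rightarrow> nat \<Rightarrow> nat \<Rightarrow> 'k cd" where
  "cd_basis K g 0 i = \<one>\<^bsub>cd_base K\<^esub>"
| "cd_basis K g (Suc t) i =
    (if i < 2 ^ t then Pr (cd_basis K g t i) \<zero>\<^bsub>cayley_dickson K g t\<^esub>
     else Pr \<zero>\<^bsub>cayley_dickson K g t\<^esub> (cd_basis K g t (i - 2 ^ t)))"

abbreviation neg_ones :: "nat \<Rightarrow> nat \<Rightarrow> int" where
  "neg_ones q \<equiv> (\<lambda>_. \<ominus>\<^bsub>residue_ring (int q)\<^esub> \<one>\<^bsub>residue_ring (int q)\<^esub>)"

definition A_alg :: "nat \<Rightarrow> nat \<Rightarrow> (int, int cd) inv_algebra" where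
  "A_alg q t = cayley_dickson (residue_ring (int q)) (neg_ones q) t"

text \<open>The scalars are reduced by \<open>mod\<close>, since \<open>residue_ring (int q)\<close> has carrier \<open>{0..q - 1}\<close>.\<close>

definition l_element :: "nat \<Rightarrow> nat \<Rightarrow> nat \<Rightarrow> nat \<Rightarrow> int cd" where
  "l_element l q t n =
    (\<Oplus>\<^bsub>A_alg q t\<^esub> i \<in> {..<2 ^ t}.
      (int (l_number l (n + i)) mod int q) \<odot>\<^bsub>A_alg q t\<^esub>
        cd_basis (residue_ring (int q)) (neg_ones q) t i)"

definition idempotent_element :: "('v, 'm) ring_scheme \<Rightarrow> 'v \<Rightarrow> bool" where
  "idempotent_element A x \<longleftrightarrow> x \<noteq> \<zero>\<^bsub>A\<^esub> \<and> x \<noteq> \<one>\<^bsub>A\<^esub> \<and> x \<otimes>\<^bsub>A\<^esub> x = x"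

end

theory Submission
  imports Defs
begin

text \<open>
  Everything about an element \<open>x\<close> of a Cayley-Dickson algebra that matters here is contained in two
  scalars: its trace \<open>x + invol x\<close> and its norm \<open>x (invol x) = (invol x) x\<close>. An element of nonzero
  norm is invertible, its inverse being the conjugate divided by the norm (\<open>Units_of_norm\<close>), and an
  idempotent other than \<open>0\<close> and \<open>1\<close> has trace \<open>1\<close> and norm \<open>0\<close> (\<open>idempotent_trace_norm\<close>).

  When all parameters are \<open>-1\<close>, the norm is the sum of the squares of the coordinates
  (\<open>cd_norm_of_coords\<close>), so the norm of \<open>P\<^sub>n\<close> is a sum of squares of \<open>2\<^sup>t\<close> consecutive \<open>l\<close>-numbers.
  This sum has a closed form (\<open>sum_squares_l_number\<close>): it is \<open>S\<^sub>t p\<^sub>N\<close> with the odd index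
  \<open>N = 2 n + 2\<^sup>t - 1\<close>. The trace of \<open>P\<^sub>n\<close> is \<open>2 p\<^sub>n\<close>.

  Since \<open>q\<close> does not divide \<open>S\<^sub>t\<close>, the norm of \<open>P\<^sub>n\<close> vanishes in \<open>\<int>\<^sub>q\<close> exactly when \<open>q\<close> divides \<open>p\<^sub>N\<close>,
  which means that \<open>d\<close> divides \<open>N\<close> (\<open>dvd_l_number_iff\<close>). An even \<open>d\<close> cannot divide the odd
  number \<open>N\<close>, so \<open>P\<^sub>n\<close> is invertible. An odd \<open>d\<close> that divides both \<open>N\<close> and \<open>2\<^sup>t - 1\<close> divides \<open>n\<close>;
  then the trace \<open>2 p\<^sub>n\<close> is \<open>0\<close> and not \<open>1\<close>, so \<open>P\<^sub>n\<close> is not idempotent.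
\<close>

section \<open>Divisibility and sums of squares of \<open>l\<close>-numbers\<close>

text \<open>
  The top left entry of a product of two powers of the matrix with rows \<open>(l, 1)\<close> and \<open>(1, 0)\<close>, whose powers
  have \<open>l\<close>-numbers as entries. It drives both divisibility (take \<open>n + 1 = d\<close>) and the
  evaluation of sums of two squares (take \<open>m = n\<close>).
\<close>

lemma l_number_add:
  "l_number l (m + n + 1) = l_number l (m + 1) * l_number l (n + 1) + l_number l m * l_number l n"
proof (induction n arbitrary: m)
  case 0
  show ?case by simp
next
  case (Suc n)
  have "l_number l (m + Suc n + 1) = l_number l (Suc m + n + 1)"
    by simp
  also have "\<dots> = l_number l (Suc (Suc m)) * l_number l (Suc n) + l_number l (Suc m) * l_number l n"
    using Suc.IH[of "Suc m"] by (simp del: l_number.simps)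
  also have "\<dots> = l_number l (Suc m) * l_number l (Suc (Suc n)) + l_number l m * l_number l (Suc n)"
    by (simp add: distrib_left distrib_right ac_simps)
  finally show ?case
    by (simp del: l_number.simps)
qed

text \<open>
  The coefficient of the older term in the recurrence is \<open>1\<close>, so the recurrence can be run
  backwards modulo any \<open>q\<close>.
\<close>

lemma l_number_step_back:
  assumes "int (l_number l (Suc i)) mod q = int (l_number l (Suc j)) mod q"
    and "int (l_number l (Suc (Suc i))) mod q = int (l_number l (Suc (Suc j))) mod q"
  shows "int (l_number l i) mod q = int (l_number l j) mod q"
proof -
  have recurrence: "int (l_number l n) = int (l_number l (Suc (Suc n))) - int l * int (l_number l (Suc n))" for n
    by simp
  show ?thesis
    unfolding recurrence[of i] recurrence[of j]
    by (rule mod_diff_cong[OF assms(2) mod_mult_cong[OF refl assms(1)]])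
qed

text \<open>
  There are finitely many pairs of consecutive residues, so some pair repeats; running the
  recurrence backwards moves the repetition to index \<open>0\<close>, where the residue is \<open>0\<close>. This makes
  the \<open>LEAST\<close> that defines \<open>d\<close> below meaningful.
\<close>

lemma exists_l_number_dvd:
  assumes "q > 0"
  shows "\<exists>m>0. q dvd l_number l m"
proof -
  define F where "F n = (int (l_number l n) mod int q, int (l_number l (Suc n)) mod int q)" for n
  have "range F \<subseteq> {0..<int q} \<times> {0..<int q}"
    using assms by (auto simp: F_def)
  then have "finite (range F)"
    by (rule finite_subset) simp
  then have "\<not> inj F"
    using finite_imageD by blast
  then obtain i j where ij: "i < j" "F i = F j"
    unfolding inj_def by (metis linorder_neqE_nat)
  have "\<lbrakk>i < j; F i = F j\<rbrakk> \<Longrightarrow> F 0 = F (j - i)" for i j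
  proof (induction i arbitrary: j)
    case (Suc i)
    then obtain j' where j': "j = Suc j'" by (metis less_imp_Suc_add)
    have "F i = F j'"
      using Suc.prems(2) l_number_step_back[of l i q j'] by (simp add: F_def j' del: l_number.simps)
    then show ?case using Suc.IH[of j'] Suc.prems(1) j' by simp
  qed simp
  then have "F 0 = F (j - i)" using ij by blast
  then have "int q dvd int (l_number l (j - i))" by (auto simp: F_def)
  then show ?thesis using ij(1) by (intro exI[of _ "j - i"]) simp
qed

text \<open>
  By the addition formula \<open>p\<^bsub>m+d\<^esub> \<equiv> p\<^sub>m p\<^bsub>d-1\<^esub>\<close> modulo \<open>q\<close>, and \<open>q\<close> does not divide \<open>p\<^bsub>d-1\<^esub>\<close> by
  minimality of \<open>d\<close>. Divisibility by \<open>q\<close> is therefore periodic in the index with period \<open>d\<close>.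
\<close>

lemma dvd_l_number_iff:
  assumes "prime q" and d: "d = (LEAST m. 0 < m \<and> q dvd l_number l m)"
  shows "q dvd l_number l n \<longleftrightarrow> d dvd n"
proof -
  have "\<exists>m. 0 < m \<and> q dvd l_number l m"
    using exists_l_number_dvd assms(1) prime_gt_0_nat by blast
  then have d0: "0 < d" "q dvd l_number l d"
    unfolding d by (metis (mono_tags, lifting) LeastI_ex)+
  have least: "\<not> q dvd l_number l m" if "0 < m" "m < d" for m
    using that not_less_Least unfolding d by blast
  obtain e where e: "d = Suc e" using d0 gr0_implies_Suc by blast
  (* For e = 0 minimality says nothing, since l_number l 0 = 0; but then d = 1 and q would
     divide l_number l 1 = 1. *)
  have e_coprime: "\<not> q dvd l_number l e"
  proof (cases "e = 0")
    case True
    then show ?thesis using d0 e assms(1) by auto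
  next
    case False
    then show ?thesis using least e by simp
  qed
  have shift: "q dvd l_number l (m + d) \<longleftrightarrow> q dvd l_number l m" for m
  proof -
    have "l_number l (m + d) = l_number l (m + 1) * l_number l d + l_number l m * l_number l e"
      using l_number_add[of l m e] e by simp
    then have "q dvd l_number l (m + d) \<longleftrightarrow> q dvd l_number l m * l_number l e"
      using d0(2) by (simp add: dvd_add_right_iff)
    then show ?thesis
      using e_coprime assms(1) prime_dvd_mult_iff by blast
  qed
  show ?thesis
  proof (induction n rule: less_induct)
    case (less n)
    show ?case
    proof (cases "n < d")
      case True
      then show ?thesis using least[of n] by (cases "n = 0") auto
    next
      case False
      then show ?thesis using less[of "n - d"] shift[of "n - d"] d0(1)
        by (simp add: dvd_minus_self)
    qed
  qed
qed

text \<open>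
  With \<open>\<alpha>, \<beta>\<close> the roots of \<open>x\<^sup>2 = l x + 1\<close>, the number \<open>M\<^bsub>k+1\<^esub>\<close> is \<open>\<alpha>\<^bsup>2^k\<^esup> + \<beta>\<^bsup>2^k\<^esup>\<close>, and for
  \<open>k \<ge> 1\<close> the product \<open>(\<alpha>\<beta>)\<^bsup>2^k\<^esup>\<close> is \<open>1\<close>. So the \<open>l\<close>-numbers whose indices
  advance in steps of \<open>2\<^sup>k\<close> satisfy a recurrence with middle coefficient \<open>M\<^bsub>k+1\<^esub>\<close>. The induction
  avoids the roots: applying the identity three times doubles the step and turns \<open>M\<close> into
  \<open>M\<^sup>2 - 2\<close>.
\<close>

lemma l_number_add_M_number:
  assumes "k \<ge> 1"
  shows "int (l_number l (m + 2 ^ Suc k)) + int (l_number l m)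
    = M_number l (Suc k) * int (l_number l (m + 2 ^ k))"
  using assms
proof (induction k arbitrary: m rule: dec_induct)
  case base
  have "m + 4 = Suc (Suc (Suc (Suc m)))" "m + 2 = Suc (Suc m)" by simp_all
  then show ?case by (simp add: M_number.simps power2_eq_square algebra_simps)
next
  case (step k)
  have M: "M_number l (Suc (Suc k)) = (M_number l (Suc k))\<^sup>2 - 2"
    using step by (subst M_number.simps) simp
  have a: "M_number l (Suc k) * int (l_number l (m + 2 ^ k))
    = int (l_number l (m + 2 ^ Suc k)) + int (l_number l m)"
    using step.IH[of m] by simp
  have b: "M_number l (Suc k) * int (l_number l (m + 2 ^ Suc k))
    = int (l_number l (m + 2 ^ k + 2 ^ Suc k)) + int (l_number l (m + 2 ^ k))"
    using step.IH[of "m + 2 ^ k"] by (simp add: ac_simps mult_2)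
  have c: "M_number l (Suc k) * int (l_number l (m + 2 ^ k + 2 ^ Suc k))
    = int (l_number l (m + 2 ^ Suc (Suc k))) + int (l_number l (m + 2 ^ Suc k))"
    using step.IH[of "m + 2 ^ Suc k"] by (simp add: algebra_simps)
  have "(M_number l (Suc k))\<^sup>2 * int (l_number l (m + 2 ^ Suc k))
    = M_number l (Suc k) * int (l_number l (m + 2 ^ k + 2 ^ Suc k))
      + M_number l (Suc k) * int (l_number l (m + 2 ^ k))"
    unfolding power2_eq_square by (simp only: mult.assoc b distrib_left)
  then show ?case
    unfolding M left_diff_distrib a c by simp
qed

lemma sum_lessThan_double:
  fixes f :: "nat \<Rightarrow> 'a :: comm_monoid_add"
  shows "(\<Sum>i<2 ^ Suc t. f i) = (\<Sum>i<2 ^ t. f i) + (\<Sum>i<2 ^ t. f (2 ^ t + i))"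
  using sum.atLeastLessThan_concat[of 0 "2 ^ t" "2 ^ t + 2 ^ t" f]
    sum.shift_bounds_nat_ivl[of f 0 "2 ^ t" "2 ^ t"]
  by (simp add: lessThan_atLeast0 mult_2 add.commute)

text \<open>
  The start \<open>p\<^sub>n\<^sup>2 + p\<^bsub>n+1\<^esub>\<^sup>2 = p\<^bsub>2n+1\<^esub>\<close> is the addition formula. When \<open>t\<close> grows by one, the two halves
  of the sum have closed forms whose indices differ by \<open>2\<^bsup>t+1\<^esup>\<close>, and these merge at the cost of the
  factor \<open>M\<^bsub>t+1\<^esub>\<close>.
\<close>

lemma sum_squares_l_number:
  assumes "t \<ge> 1"
  shows "(\<Sum>i<2 ^ t. (int (l_number l (n + i)))\<^sup>2)
    = S_number l t * int (l_number l (2 * n + 2 ^ t - 1))"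
  using assms
proof (induction t arbitrary: n rule: dec_induct)
  case base
  have "2 * n + 2 - 1 = n + n + 1" by simp
  then show ?case
    using l_number_add[of l n n]
    by (simp add: S_number_def numeral_2_eq_2 power2_eq_square del: l_number.simps)
next
  case (step t)
  have S: "S_number l (Suc t) = S_number l t * M_number l (Suc t)"
    using step by (simp add: S_number_def)
  have e1: "2 * (n + 2 ^ t) + 2 ^ t - 1 = (2 * n + 2 ^ t - 1) + 2 ^ Suc t"
    "2 * n + 2 ^ Suc t - 1 = (2 * n + 2 ^ t - 1) + 2 ^ t" by simp_all
  show ?case
    unfolding sum_lessThan_double add.assoc[symmetric] step.IH e1(1)
    using l_number_add_M_number[OF step.hyps(1), of l "2 * n + 2 ^ t - 1"]
    unfolding e1(2) S by (simp only: distrib_left[symmetric] mult.assoc add.commute)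
qed

section \<open>Algebras with a linear conjugation\<close>

text \<open>
  The structure that the doubling step passes on without knowledge of traces and norms: a bilinear
  product with unit and an involutive linear conjugation that fixes the unit. It suffices for
  computing trace and norm of a pair from those of its components, so these scalars can be found by a
  separate induction instead of being postulated here.
\<close>

locale conjugation_algebra = module K A
  for K (structure) and A :: "('k, 'v, 'z) inv_algebra_scheme" (structure) +
  assumes mult_closed [simp, intro]:
      "\<lbrakk>x \<in> carrier A; y \<in> carrier A\<rbrakk> \<Longrightarrow> x \<otimes>\<^bsub>A\<^esub> y \<in> carrier A"
    and mult_l_distr:
      "\<lbrakk>x \<in> carrier A; y \<in> carrier A; z \<in> carrier A\<rbrakk> \<Longrightarrow>
        (x \<oplus>\<^bsub>A\<^esub> y) \<otimes>\<^bsub>A\<^esub> z = x \<otimes>\<^bsub>A\<^esub> z \<oplus>\<^bsub>A\<^esub> y \<otimes>\<^bsub>A\<^esub> z"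
    and mult_r_distr:
      "\<lbrakk>x \<in> carrier A; y \<in> carrier A; z \<in> carrier A\<rbrakk> \<Longrightarrow>
        z \<otimes>\<^bsub>A\<^esub> (x \<oplus>\<^bsub>A\<^esub> y) = z \<otimes>\<^bsub>A\<^esub> x \<oplus>\<^bsub>A\<^esub> z \<otimes>\<^bsub>A\<^esub> y"
    and smult_mult_l:
      "\<lbrakk>c \<in> carrier K; x \<in> carrier A; y \<in> carrier A\<rbrakk> \<Longrightarrow>
        (c \<odot>\<^bsub>A\<^esub> x) \<otimes>\<^bsub>A\<^esub> y = c \<odot>\<^bsub>A\<^esub> (x \<otimes>\<^bsub>A\<^esub> y)"
    and smult_mult_r:
      "\<lbrakk>c \<in> carrier K; x \<in> carrier A; y \<in> carrier A\<rbrakk> \<Longrightarrow>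
        x \<otimes>\<^bsub>A\<^esub> (c \<odot>\<^bsub>A\<^esub> y) = c \<odot>\<^bsub>A\<^esub> (x \<otimes>\<^bsub>A\<^esub> y)"
    and unit_closed [simp, intro]: "\<one>\<^bsub>A\<^esub> \<in> carrier A"
    and unit_l [simp]: "x \<in> carrier A \<Longrightarrow> \<one>\<^bsub>A\<^esub> \<otimes>\<^bsub>A\<^esub> x = x"
    and unit_r [simp]: "x \<in> carrier A \<Longrightarrow> x \<otimes>\<^bsub>A\<^esub> \<one>\<^bsub>A\<^esub> = x"
    and invol_closed [simp, intro]: "x \<in> carrier A \<Longrightarrow> invol A x \<in> carrier A"
    and invol_add:
      "\<lbrakk>x \<in> carrier A; y \<in> carrier A\<rbrakk> \<Longrightarrow> invol A (x \<oplus>\<^bsub>A\<^esub> y) = invol A x \<oplus>\<^bsub>A\<^esub> invol A y"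
    and invol_smult:
      "\<lbrakk>c \<in> carrier K; x \<in> carrier A\<rbrakk> \<Longrightarrow> invol A (c \<odot>\<^bsub>A\<^esub> x) = c \<odot>\<^bsub>A\<^esub> invol A x"
    and invol_invol [simp]: "x \<in> carrier A \<Longrightarrow> invol A (invol A x) = x"
    and invol_one [simp]: "invol A \<one>\<^bsub>A\<^esub> = \<one>\<^bsub>A\<^esub>"
begin

lemma mult_zero_l [simp]:
  assumes "x \<in> carrier A"
  shows "\<zero>\<^bsub>A\<^esub> \<otimes>\<^bsub>A\<^esub> x = \<zero>\<^bsub>A\<^esub>"
  using smult_mult_l[of \<zero> "\<zero>\<^bsub>A\<^esub>" x] assms by simp

lemma mult_zero_r [simp]:
  assumes "x \<in> carrier A"
  shows "x \<otimes>\<^bsub>A\<^esub> \<zero>\<^bsub>A\<^esub> = \<zero>\<^bsub>A\<^esub>"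
  using smult_mult_r[of \<zero> x "\<zero>\<^bsub>A\<^esub>"] assms by simp

lemma mult_minus_l:
  assumes "x \<in> carrier A" "y \<in> carrier A"
  shows "(\<ominus>\<^bsub>A\<^esub> x) \<otimes>\<^bsub>A\<^esub> y = \<ominus>\<^bsub>A\<^esub> (x \<otimes>\<^bsub>A\<^esub> y)"
proof -
  have "(\<ominus>\<^bsub>A\<^esub> x) \<otimes>\<^bsub>A\<^esub> y \<oplus>\<^bsub>A\<^esub> x \<otimes>\<^bsub>A\<^esub> y = \<zero>\<^bsub>A\<^esub>"
    using mult_l_distr[of "\<ominus>\<^bsub>A\<^esub> x" x y] assms by (simp add: M.l_neg)
  then show ?thesis
    using assms by (simp add: M.minus_equality)
qed

lemma mult_minus_r:
  assumes "x \<in> carrier A" "y \<in> carrier A"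
  shows "x \<otimes>\<^bsub>A\<^esub> (\<ominus>\<^bsub>A\<^esub> y) = \<ominus>\<^bsub>A\<^esub> (x \<otimes>\<^bsub>A\<^esub> y)"
proof -
  have "x \<otimes>\<^bsub>A\<^esub> (\<ominus>\<^bsub>A\<^esub> y) \<oplus>\<^bsub>A\<^esub> x \<otimes>\<^bsub>A\<^esub> y = \<zero>\<^bsub>A\<^esub>"
    using mult_r_distr[of "\<ominus>\<^bsub>A\<^esub> y" y x] assms by (simp add: M.l_neg)
  then show ?thesis
    using assms by (simp add: M.minus_equality)
qed

lemma invol_zero [simp]: "invol A \<zero>\<^bsub>A\<^esub> = \<zero>\<^bsub>A\<^esub>"
  using invol_smult[of \<zero> "\<zero>\<^bsub>A\<^esub>"] by simp

lemma invol_minus: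
  assumes "x \<in> carrier A"
  shows "invol A (\<ominus>\<^bsub>A\<^esub> x) = \<ominus>\<^bsub>A\<^esub> (invol A x)"
proof -
  have "invol A (\<ominus>\<^bsub>A\<^esub> x) \<oplus>\<^bsub>A\<^esub> invol A x = \<zero>\<^bsub>A\<^esub>"
    using invol_add[of "\<ominus>\<^bsub>A\<^esub> x" x] assms by (simp add: M.l_neg)
  then show ?thesis
    using assms by (simp add: M.minus_equality)
qed

text \<open>
  The inverse is the conjugate divided by the norm. Without associativity this still works, because
  scalars can be moved out of a product.
\<close>

lemma Units_of_norm:
  assumes "field K" and x: "x \<in> carrier A" and c: "c \<in> carrier K" "c \<noteq> \<zero>"
    and "x \<otimes>\<^bsub>A\<^esub> invol A x = c \<odot>\<^bsub>A\<^esub> \<one>\<^bsub>A\<^esub>" "invol A x \<otimes>\<^bsub>A\<^esub> x = c \<odot>\<^bsub>A\<^esub> \<one>\<^bsub>A\<^esub>"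
  shows "x \<in> Units A"
proof -
  interpret K: field K by fact
  have u: "c \<in> Units K" using c K.field_Units by blast
  let ?y = "inv c \<odot>\<^bsub>A\<^esub> invol A x"
  have "x \<otimes>\<^bsub>A\<^esub> ?y = \<one>\<^bsub>A\<^esub>" "?y \<otimes>\<^bsub>A\<^esub> x = \<one>\<^bsub>A\<^esub>"
    using assms u by (simp_all add: smult_mult_l smult_mult_r flip: smult_assoc1)
  then show ?thesis
    using x R.Units_inv_closed[OF u] unfolding Units_def by (auto intro!: bexI[of _ ?y])
qed

text \<open>
  Write \<open>c\<close> for the trace and \<open>d\<close> for the norm of \<open>x\<close>. Multiplying \<open>x\<close> by \<open>x + invol A x = c 1\<close> gives
  \<open>c x = x\<^sup>2 + d 1\<close>, so an idempotent satisfies \<open>(c - 1) x = d 1\<close>. If \<open>c \<noteq> 1\<close>, then \<open>x\<close> is a scalar \<open>r 1\<close>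
  with \<open>(r - 1) x = 0\<close>; since \<open>x \<noteq> 0\<close>, this forces \<open>r = 1\<close> and \<open>x = 1\<close>. So \<open>c = 1\<close>, and then \<open>d = 0\<close>.
\<close>

lemma idempotent_trace_norm:
  assumes "field K" and x: "x \<in> carrier A" and c: "c \<in> carrier K" "d \<in> carrier K"
    and trace: "x \<oplus>\<^bsub>A\<^esub> invol A x = c \<odot>\<^bsub>A\<^esub> \<one>\<^bsub>A\<^esub>"
    and norm: "x \<otimes>\<^bsub>A\<^esub> invol A x = d \<odot>\<^bsub>A\<^esub> \<one>\<^bsub>A\<^esub>"
    and idem: "idempotent_element A x"
  shows "c = \<one> \<and> d = \<zero>"
proof -
  interpret K: field K by fact
  have x0: "x \<noteq> \<zero>\<^bsub>A\<^esub>" and x1: "x \<noteq> \<one>\<^bsub>A\<^esub>" and xx: "x \<otimes>\<^bsub>A\<^esub> x = x"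
    using idem by (auto simp: idempotent_element_def)
  have scalar_zero: "r = \<zero>" if "r \<in> carrier K" "y \<in> carrier A" "r \<odot>\<^bsub>A\<^esub> y = \<zero>\<^bsub>A\<^esub>" "y \<noteq> \<zero>\<^bsub>A\<^esub>" for r y
  proof (rule ccontr)
    assume "r \<noteq> \<zero>"
    then have u: "r \<in> Units K" using that K.field_Units by blast
    have "y = inv r \<odot>\<^bsub>A\<^esub> (r \<odot>\<^bsub>A\<^esub> y)"
      using u that(1,2) by (simp flip: smult_assoc1)
    then show False using that u by simp
  qed
  have one_nz: "\<one>\<^bsub>A\<^esub> \<noteq> \<zero>\<^bsub>A\<^esub>"
    using x x0 unit_l[of x] by (metis mult_zero_l)
  have "c \<odot>\<^bsub>A\<^esub> x = x \<otimes>\<^bsub>A\<^esub> (x \<oplus>\<^bsub>A\<^esub> invol A x)"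
    using x c by (simp add: trace smult_mult_r)
  also have "\<dots> = x \<oplus>\<^bsub>A\<^esub> d \<odot>\<^bsub>A\<^esub> \<one>\<^bsub>A\<^esub>"
    using x by (simp add: mult_r_distr xx norm)
  finally have quad: "c \<odot>\<^bsub>A\<^esub> x = x \<oplus>\<^bsub>A\<^esub> d \<odot>\<^bsub>A\<^esub> \<one>\<^bsub>A\<^esub>" .
  have eq: "(c \<ominus> \<one>) \<odot>\<^bsub>A\<^esub> x = d \<odot>\<^bsub>A\<^esub> \<one>\<^bsub>A\<^esub>"
  proof -
    have "(c \<ominus> \<one>) \<odot>\<^bsub>A\<^esub> x = c \<odot>\<^bsub>A\<^esub> x \<oplus>\<^bsub>A\<^esub> \<ominus>\<^bsub>A\<^esub> x"
      using x c by (simp add: R.minus_eq smult_l_distr smult_l_minus)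
    then show ?thesis
      using x c by (simp add: quad M.a_ac M.r_neg2)
  qed
  have "c = \<one>"
  proof (rule ccontr)
    assume "c \<noteq> \<one>"
    then have u: "c \<ominus> \<one> \<in> Units K" using c K.field_Units R.r_right_minus_eq by auto
    define r where "r = inv (c \<ominus> \<one>) \<otimes> d"
    have r: "r \<in> carrier K" using u c by (simp add: r_def)
    have "x = inv (c \<ominus> \<one>) \<odot>\<^bsub>A\<^esub> ((c \<ominus> \<one>) \<odot>\<^bsub>A\<^esub> x)"
      using u c x by (simp flip: smult_assoc1)
    then have xr: "x = r \<odot>\<^bsub>A\<^esub> \<one>\<^bsub>A\<^esub>"
      using u c by (simp add: eq r_def smult_assoc1)
    have "(r \<ominus> \<one>) \<odot>\<^bsub>A\<^esub> x = \<zero>\<^bsub>A\<^esub>"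
    proof -
      have "r \<odot>\<^bsub>A\<^esub> x = x"
        using xx x r smult_mult_l[of r "\<one>\<^bsub>A\<^esub>" x] by (simp flip: xr)
      then show ?thesis
        using x r by (simp add: R.minus_eq smult_l_distr smult_l_minus M.r_neg)
    qed
    then have "r = \<one>"
      using scalar_zero[of "r \<ominus> \<one>" x] x x0 r by simp
    then show False using x1 xr by simp
  qed
  moreover from this have "d = \<zero>"
    using scalar_zero[of d "\<one>\<^bsub>A\<^esub>"] eq x c one_nz by (simp add: R.minus_eq R.r_neg)
  ultimately show ?thesis by simp
qed

lemma smult_left_commute:
  assumes "a \<in> carrier K" "b \<in> carrier K" "x \<in> carrier A"
  shows "a \<odot>\<^bsub>A\<^esub> (b \<odot>\<^bsub>A\<^esub> x) = b \<odot>\<^bsub>A\<^esub> (a \<odot>\<^bsub>A\<^esub> x)"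
  using assms by (simp add: R.m_comm flip: smult_assoc1)

end

section \<open>Trace, norm and coordinates in Cayley-Dickson algebras\<close>

lemma cd_base_simps:
  "carrier (cd_base K) = Scal ` carrier K"
  "x \<otimes>\<^bsub>cd_base K\<^esub> y = Scal (scal x \<otimes>\<^bsub>K\<^esub> scal y)"
  "\<one>\<^bsub>cd_base K\<^esub> = Scal \<one>\<^bsub>K\<^esub>"
  "\<zero>\<^bsub>cd_base K\<^esub> = Scal \<zero>\<^bsub>K\<^esub>"
  "x \<oplus>\<^bsub>cd_base K\<^esub> y = Scal (scal x \<oplus>\<^bsub>K\<^esub> scal y)"
  "c \<odot>\<^bsub>cd_base K\<^esub> x = Scal (c \<otimes>\<^bsub>K\<^esub> scal x)"
  "invol (cd_base K) x = x"
  by (simp_all add: cd_base_def)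

lemma cd_double_simps:
  "carrier (cd_double A g) = {Pr a b | a b. a \<in> carrier A \<and> b \<in> carrier A}"
  "x \<otimes>\<^bsub>cd_double A g\<^esub> y =
    Pr (left x \<otimes>\<^bsub>A\<^esub> left y \<oplus>\<^bsub>A\<^esub> g \<odot>\<^bsub>A\<^esub> (invol A (right y) \<otimes>\<^bsub>A\<^esub> right x))
       (right x \<otimes>\<^bsub>A\<^esub> invol A (left y) \<oplus>\<^bsub>A\<^esub> right y \<otimes>\<^bsub>A\<^esub> left x)"
  "\<one>\<^bsub>cd_double A g\<^esub> = Pr \<one>\<^bsub>A\<^esub> \<zero>\<^bsub>A\<^esub>"
  "\<zero>\<^bsub>cd_double A g\<^esub> = Pr \<zero>\<^bsub>A\<^esub> \<zero>\<^bsub>A\<^esub>"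
  "x \<oplus>\<^bsub>cd_double A g\<^esub> y = Pr (left x \<oplus>\<^bsub>A\<^esub> left y) (right x \<oplus>\<^bsub>A\<^esub> right y)"
  "c \<odot>\<^bsub>cd_double A g\<^esub> x = Pr (c \<odot>\<^bsub>A\<^esub> left x) (c \<odot>\<^bsub>A\<^esub> right x)"
  "invol (cd_double A g) x = Pr (invol A (left x)) (\<ominus>\<^bsub>A\<^esub> right x)"
  by (simp_all add: cd_double_def)

lemma conjugation_algebra_cd_base:
  assumes "cring K"
  shows "conjugation_algebra K (cd_base K)"
proof -
  interpret cring K by fact
  have "abelian_group (cd_base K)"
    by (rule abelian_groupI) (auto simp: cd_base_simps a_ac intro!: bexI[of _ "\<ominus>\<^bsub>K\<^esub> _"] l_neg)
  then have "module K (cd_base K)"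
    by (intro moduleI assms) (auto simp: cd_base_simps l_distr r_distr m_assoc)
  then show ?thesis
    by (intro conjugation_algebra.intro conjugation_algebra_axioms.intro)
      (auto simp: cd_base_simps l_distr r_distr m_ac)
qed

lemma conjugation_algebra_cd_double:
  assumes "conjugation_algebra K A" "g \<in> carrier K"
  shows "conjugation_algebra K (cd_double A g)"
proof -
  interpret conjugation_algebra K A by fact
  have ab: "abelian_group (cd_double A g)"
  proof (rule abelian_groupI)
    fix x assume "x \<in> carrier (cd_double A g)"
    then show "\<exists>y\<in>carrier (cd_double A g). y \<oplus>\<^bsub>cd_double A g\<^esub> x = \<zero>\<^bsub>cd_double A g\<^esub>"
      by (intro bexI[of _ "Pr (\<ominus>\<^bsub>A\<^esub> left x) (\<ominus>\<^bsub>A\<^esub> right x)"]) (auto simp: cd_double_simps M.l_neg)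
  qed (auto simp: cd_double_simps M.a_ac)
  have "module K (cd_double A g)"
    by (intro moduleI ab R.is_cring) (auto simp: cd_double_simps smult_l_distr smult_r_distr smult_assoc1)
  then show ?thesis
    using assms(2)
    by (intro conjugation_algebra.intro conjugation_algebra_axioms.intro)
      (auto simp: cd_double_simps mult_l_distr mult_r_distr smult_mult_l smult_mult_r smult_r_distr
        invol_add invol_smult M.a_ac M.minus_add smult_r_minus smult_left_commute)
qed

lemma conjugation_algebra_cayley_dickson:
  assumes "cring K" "\<And>i. g i \<in> carrier K"
  shows "conjugation_algebra K (cayley_dickson K g t)"
  by (induction t) (simp_all add: assms conjugation_algebra_cd_base conjugation_algebra_cd_double)

text \<open>The coefficient of \<open>e\<^sub>0\<close>; the trace is twice this value.\<close>

primrec cd_real :: "nat \<Rightarrow> 'k cd \<Rightarrow> 'k" where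
  "cd_real 0 x = scal x"
| "cd_real (Suc t) x = cd_real t (left x)"

text \<open>
  The recursion is the outcome of multiplying \<open>(a, b)\<close> by its conjugate in the doubled algebra; see
  \<open>cd_norm_mult\<close>.
\<close>

primrec cd_norm :: "('k, 'm) ring_scheme \<Rightarrow> (nat \<Rightarrow> 'k) \<Rightarrow> nat \<Rightarrow> 'k cd \<Rightarrow> 'k" where
  "cd_norm K g 0 x = scal x \<otimes>\<^bsub>K\<^esub> scal x"
| "cd_norm K g (Suc t) x =
    cd_norm K g t (left x) \<ominus>\<^bsub>K\<^esub> g (Suc t) \<otimes>\<^bsub>K\<^esub> cd_norm K g t (right x)"

primrec cd_of_coords :: "nat \<Rightarrow> (nat \<Rightarrow> 'k) \<Rightarrow> 'k cd" where
  "cd_of_coords 0 f = Scal (f 0)"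
| "cd_of_coords (Suc t) f = Pr (cd_of_coords t f) (cd_of_coords t (\<lambda>i. f (2 ^ t + i)))"

lemma cd_real_closed: "x \<in> carrier (cayley_dickson K g t) \<Longrightarrow> cd_real t x \<in> carrier K"
  by (induction t arbitrary: x) (auto simp: cd_base_simps cd_double_simps)

lemma cd_norm_closed:
  assumes "cring K" "\<And>i. g i \<in> carrier K" "x \<in> carrier (cayley_dickson K g t)"
  shows "cd_norm K g t x \<in> carrier K"
proof -
  interpret cring K by fact
  show ?thesis using assms(3)
    by (induction t arbitrary: x) (auto simp: cd_base_simps cd_double_simps assms)
qed

lemma cd_trace:
  assumes "cring K" "\<And>i. g i \<in> carrier K" "x \<in> carrier (cayley_dickson K g t)"
  shows "x \<oplus>\<^bsub>cayley_dickson K g t\<^esub> invol (cayley_dickson K g t) x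
    = (cd_real t x \<oplus>\<^bsub>K\<^esub> cd_real t x) \<odot>\<^bsub>cayley_dickson K g t\<^esub> \<one>\<^bsub>cayley_dickson K g t\<^esub>"
  using assms(3)
proof (induction t arbitrary: x)
  case 0
  interpret cring K by fact
  from 0 show ?case by (auto simp: cd_base_simps)
next
  case (Suc t)
  interpret conjugation_algebra K "cayley_dickson K g t"
    by (rule conjugation_algebra_cayley_dickson) fact+
  from Suc show ?case by (auto simp: cd_double_simps cd_real_closed M.r_neg)
qed

text \<open>
  In \<open>(a, b) (invol a, -b)\<close> the second component \<open>b a - b a\<close> vanishes and the first is
  \<open>a (invol a) - \<gamma> (invol b) b\<close>. It contains the norm of \<open>b\<close> with its factors in the
  opposite order, so both orders have to be carried through the induction together.
\<close>

lemma cd_norm_mult: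
  assumes "cring K" "\<And>i. g i \<in> carrier K" "x \<in> carrier (cayley_dickson K g t)"
  defines "A \<equiv> cayley_dickson K g t"
  shows "x \<otimes>\<^bsub>A\<^esub> invol A x = cd_norm K g t x \<odot>\<^bsub>A\<^esub> \<one>\<^bsub>A\<^esub>"
    and "invol A x \<otimes>\<^bsub>A\<^esub> x = cd_norm K g t x \<odot>\<^bsub>A\<^esub> \<one>\<^bsub>A\<^esub>"
proof -
  have "x \<otimes>\<^bsub>A\<^esub> invol A x = cd_norm K g t x \<odot>\<^bsub>A\<^esub> \<one>\<^bsub>A\<^esub> \<and>
    invol A x \<otimes>\<^bsub>A\<^esub> x = cd_norm K g t x \<odot>\<^bsub>A\<^esub> \<one>\<^bsub>A\<^esub>"
    unfolding A_def using assms(3)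
  proof (induction t arbitrary: x)
    case 0
    interpret cring K by fact
    from 0 show ?case by (auto simp: cd_base_simps)
  next
    case (Suc t)
    interpret conjugation_algebra K "cayley_dickson K g t"
      by (rule conjugation_algebra_cayley_dickson) fact+
    obtain a b where x: "x = Pr a b"
      and ab: "a \<in> carrier (cayley_dickson K g t)" "b \<in> carrier (cayley_dickson K g t)"
      using Suc.prems by (auto simp: cd_double_simps)
    have closed: "cd_norm K g t a \<in> carrier K" "cd_norm K g t b \<in> carrier K"
      using cd_norm_closed assms ab by blast+
    show ?case
      using Suc.IH[OF ab(1)] Suc.IH[OF ab(2)] ab closed assms(2)
      by (simp add: x cd_double_simps invol_minus mult_minus_l mult_minus_r M.l_neg M.r_neg
        smult_r_minus smult_l_minus smult_l_distr smult_assoc1 R.minus_eq)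
  qed
  then show "x \<otimes>\<^bsub>A\<^esub> invol A x = cd_norm K g t x \<odot>\<^bsub>A\<^esub> \<one>\<^bsub>A\<^esub>"
    and "invol A x \<otimes>\<^bsub>A\<^esub> x = cd_norm K g t x \<odot>\<^bsub>A\<^esub> \<one>\<^bsub>A\<^esub>" by auto
qed

lemma cd_of_coords_closed:
  "(\<And>i. f i \<in> carrier K) \<Longrightarrow> cd_of_coords t f \<in> carrier (cayley_dickson K g t)"
  by (induction t arbitrary: f) (auto simp: cd_base_simps cd_double_simps)

lemma cd_real_of_coords: "cd_real t (cd_of_coords t f) = f 0"
  by (induction t) auto

lemma cd_basis_closed:
  assumes "cring K" "\<And>i. g i \<in> carrier K"
  shows "cd_basis K g t i \<in> carrier (cayley_dickson K g t)"
proof (induction t arbitrary: i)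
  case 0
  interpret cring K by fact
  show ?case by (auto simp: cd_base_simps)
next
  case (Suc t)
  interpret conjugation_algebra K "cayley_dickson K g t"
    by (rule conjugation_algebra_cayley_dickson) fact+
  show ?case using Suc by (auto simp: cd_double_simps)
qed

lemma finsum_cd_double:
  assumes "abelian_group A" "abelian_group (cd_double A g)" "finite I"
    "u \<in> I \<rightarrow> carrier A" "v \<in> I \<rightarrow> carrier A"
  shows "(\<Oplus>\<^bsub>cd_double A g\<^esub> i \<in> I. Pr (u i) (v i)) = Pr (\<Oplus>\<^bsub>A\<^esub> i \<in> I. u i) (\<Oplus>\<^bsub>A\<^esub> i \<in> I. v i)"
proof -
  interpret A: abelian_group A by fact
  interpret D: abelian_group "cd_double A g" by fact
  show ?thesis
    using assms(3-5)
  proof (induction I rule: finite_induct)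
    case empty
    then show ?case by (simp add: cd_double_simps)
  next
    case (insert i I)
    then show ?case by (subst D.finsum_insert) (auto simp: cd_double_simps Pi_iff)
  qed
qed

text \<open>
  The basis of the doubled algebra consists of the pairs \<open>(e\<^sub>i, 0)\<close> followed by the pairs
  \<open>(0, e\<^sub>i)\<close>, so the two halves of the index range contribute the two components.
\<close>

lemma finsum_cd_basis:
  assumes "cring K" "\<And>i. g i \<in> carrier K" "\<And>i. f i \<in> carrier K"
  shows "(\<Oplus>\<^bsub>cayley_dickson K g t\<^esub> i \<in> {..<2 ^ t}. f i \<odot>\<^bsub>cayley_dickson K g t\<^esub> cd_basis K g t i)
    = cd_of_coords t f"
  using assms(3)
proof (induction t arbitrary: f)
  case 0
  interpret cring K by fact
  interpret B: conjugation_algebra K "cd_base K"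
    by (rule conjugation_algebra_cd_base) fact
  have "{..<1} = {0::nat}" by auto
  then show ?case using 0 by (simp add: cd_base_simps)
next
  case (Suc t)
  let ?A = "cayley_dickson K g t" and ?D = "cayley_dickson K g (Suc t)"
  interpret A: conjugation_algebra K ?A
    by (rule conjugation_algebra_cayley_dickson) fact+
  interpret D: conjugation_algebra K ?D
    by (rule conjugation_algebra_cayley_dickson) fact+
  let ?s = "\<lambda>i. f i \<odot>\<^bsub>?D\<^esub> cd_basis K g (Suc t) i"
  have s: "?s i \<in> carrier ?D" for i
    by (intro D.smult_closed Suc.prems cd_basis_closed assms(1,2))
  have dbl: "(\<Oplus>\<^bsub>?D\<^esub> i \<in> {..<2 ^ t}. Pr (u i) (v i)) = Pr (\<Oplus>\<^bsub>?A\<^esub> i \<in> {..<2 ^ t}. u i) (\<Oplus>\<^bsub>?A\<^esub> i \<in> {..<2 ^ t}. v i)"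
    if "\<And>i. u i \<in> carrier ?A" "\<And>i. v i \<in> carrier ?A" for u v :: "nat \<Rightarrow> 'a cd"
    using finsum_cd_double[of ?A "g (Suc t)" "{..<2 ^ t}" u v] that
      A.abelian_group_axioms D.abelian_group_axioms by auto
  have basis: "cd_basis K g t i \<in> carrier ?A" for i
    by (rule cd_basis_closed) fact+
  have img: "{..<2 ^ Suc t} = {..<2 ^ t} \<union> (\<lambda>i. 2 ^ t + i) ` {..<2 ^ t :: nat}"
    by (auto simp: image_iff Bex_def) presburger
  have "finsum ?D ?s {..<2 ^ Suc t} = finsum ?D ?s {..<2 ^ t} \<oplus>\<^bsub>?D\<^esub> finsum ?D ?s ((\<lambda>i. 2 ^ t + i) ` {..<2 ^ t})"
    unfolding img using s by (intro D.finsum_Un_disjoint) auto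
  also have "finsum ?D ?s ((\<lambda>i. 2 ^ t + i) ` {..<2 ^ t}) = (\<Oplus>\<^bsub>?D\<^esub> i \<in> {..<2 ^ t}. ?s (2 ^ t + i))"
    using s by (intro D.finsum_reindex) (auto simp: inj_on_def)
  also have "\<dots> = (\<Oplus>\<^bsub>?D\<^esub> i \<in> {..<2 ^ t}. Pr \<zero>\<^bsub>?A\<^esub> (f (2 ^ t + i) \<odot>\<^bsub>?A\<^esub> cd_basis K g t i))"
    using Suc.prems basis by (intro D.finsum_cong') (auto simp: cd_double_simps)
  also have "\<dots> = Pr \<zero>\<^bsub>?A\<^esub> (cd_of_coords t (\<lambda>i. f (2 ^ t + i)))"
    using Suc.prems basis by (subst dbl) (auto simp: Suc.IH)
  also have "finsum ?D ?s {..<2 ^ t} = (\<Oplus>\<^bsub>?D\<^esub> i \<in> {..<2 ^ t}. Pr (f i \<odot>\<^bsub>?A\<^esub> cd_basis K g t i) \<zero>\<^bsub>?A\<^esub>)"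
    using Suc.prems basis by (intro D.finsum_cong') (auto simp: cd_double_simps)
  also have "\<dots> = Pr (cd_of_coords t f) \<zero>\<^bsub>?A\<^esub>"
    using Suc.prems basis by (subst dbl) (auto simp: Suc.IH)
  finally show ?case
    using Suc.prems cd_of_coords_closed[of _ K t g] by (simp add: cd_double_simps)
qed

text \<open>
  All parameters being \<open>-1\<close>, every sign in the recursion for the norm becomes positive.
\<close>

lemma cd_norm_of_coords:
  assumes "q > 1"
  shows "cd_norm (residue_ring (int q)) (neg_ones q) t (cd_of_coords t (\<lambda>i. a i mod int q))
    = (\<Sum>i<2 ^ t. (a i)\<^sup>2) mod int q"
proof -
  interpret residues "int q" "residue_ring (int q)"
    using assms by unfold_locales auto
  show ?thesis
  proof (induction t arbitrary: a)
    case 0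
    then show ?case by (simp add: res_mult_eq mod_mult_eq power2_eq_square lessThan_Suc)
  next
    case (Suc t)
    show ?case
      unfolding sum_lessThan_double
      by (simp only: cd_norm.simps cd_of_coords.simps cd.sel Suc.IH)
        (simp add: a_minus_def res_add_eq res_mult_eq res_neg_eq res_one_eq mod_simps)
  qed
qed

section \<open>The \<open>l\<close>-elements\<close>

lemma l_element_eq_coords:
  assumes "q > 1"
  shows "l_element l q t n = cd_of_coords t (\<lambda>i. int (l_number l (n + i)) mod int q)"
proof -
  interpret R: residues "int q" "residue_ring (int q)"
    using assms by unfold_locales auto
  show ?thesis
    unfolding l_element_def A_alg_def
    by (intro finsum_cd_basis R.cring) simp_all
qed

lemma conjugation_algebra_A_alg:
  assumes "q > 1"
  shows "conjugation_algebra (residue_ring (int q)) (A_alg q t)"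
proof -
  interpret R: residues "int q" "residue_ring (int q)"
    using assms by unfold_locales auto
  show ?thesis
    unfolding A_alg_def by (intro conjugation_algebra_cayley_dickson R.cring) simp
qed

lemma l_element_closed:
  assumes "q > 1"
  shows "l_element l q t n \<in> carrier (A_alg q t)"
proof -
  interpret R: residues "int q" "residue_ring (int q)"
    using assms by unfold_locales auto
  show ?thesis
    unfolding l_element_eq_coords[OF assms] A_alg_def by (intro cd_of_coords_closed) auto
qed

lemma l_element_trace:
  assumes "q > 1"
  shows "l_element l q t n \<oplus>\<^bsub>A_alg q t\<^esub> invol (A_alg q t) (l_element l q t n)
    = ((2 * int (l_number l n)) mod int q) \<odot>\<^bsub>A_alg q t\<^esub> \<one>\<^bsub>A_alg q t\<^esub>"
proof -
  interpret R: residues "int q" "residue_ring (int q)"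
    using assms by unfold_locales auto
  have "cd_real t (l_element l q t n) \<oplus>\<^bsub>residue_ring (int q)\<^esub> cd_real t (l_element l q t n)
    = (2 * int (l_number l n)) mod int q"
    by (simp add: l_element_eq_coords[OF assms] cd_real_of_coords R.res_add_eq mod_simps)
  then show ?thesis
    using cd_trace[where g = "neg_ones q", OF R.cring _
        l_element_closed[OF assms, unfolded A_alg_def]]
    by (simp add: A_alg_def)
qed

lemma l_element_norm:
  assumes "q > 1" "t \<ge> 1"
  defines "x l n \<equiv> l_element l q t n"
    and "N l n \<equiv> (S_number l t * int (l_number l (2 * n + 2 ^ t - 1))) mod int q"
  shows "x l n \<otimes>\<^bsub>A_alg q t\<^esub> invol (A_alg q t) (x l n) = N l n \<odot>\<^bsub>A_alg q t\<^esub> \<one>\<^bsub>A_alg q t\<^esub>"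
    and "invol (A_alg q t) (x l n) \<otimes>\<^bsub>A_alg q t\<^esub> x l n = N l n \<odot>\<^bsub>A_alg q t\<^esub> \<one>\<^bsub>A_alg q t\<^esub>"
proof -
  interpret R: residues "int q" "residue_ring (int q)"
    using assms by unfold_locales auto
  have "cd_norm (residue_ring (int q)) (neg_ones q) t (x l n) = N l n"
    unfolding x_def N_def l_element_eq_coords[OF assms(1)] cd_norm_of_coords[OF assms(1)]
      sum_squares_l_number[OF assms(2)] ..
  then show "x l n \<otimes>\<^bsub>A_alg q t\<^esub> invol (A_alg q t) (x l n) = N l n \<odot>\<^bsub>A_alg q t\<^esub> \<one>\<^bsub>A_alg q t\<^esub>"
    and "invol (A_alg q t) (x l n) \<otimes>\<^bsub>A_alg q t\<^esub> x l n = N l n \<odot>\<^bsub>A_alg q t\<^esub> \<one>\<^bsub>A_alg q t\<^esub>"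
    using cd_norm_mult[where g = "neg_ones q", OF R.cring _
        l_element_closed[OF assms(1), unfolded A_alg_def]]
    by (simp_all add: A_alg_def x_def)
qed

lemma S_number_mult_mod_eq_0_iff:
  assumes "gcd (int q) (S_number l t) = 1"
  shows "(S_number l t * int m) mod int q = 0 \<longleftrightarrow> q dvd m"
proof -
  have "coprime (int q) (S_number l t)"
    using assms by (simp add: coprime_iff_gcd_eq_1)
  then show ?thesis
    by (simp add: mod_eq_0_iff_dvd coprime_dvd_mult_right_iff)
qed

text \<open>The norm has odd index \<open>2 n + 2\<^sup>t - 1\<close>, which an even \<open>d\<close> cannot divide.\<close>

lemma l_element_Units:
  assumes q: "prime q" "d = (LEAST m. 0 < m \<and> q dvd l_number l m)"
    and t: "t \<ge> 1" "gcd (int q) (S_number l t) = 1" and "even d"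
  shows "l_element l q t n \<in> Units (A_alg q t)"
proof -
  have q1: "q > 1" using q(1) prime_gt_1_nat by blast
  interpret R: residues_prime q "residue_ring (int q)"
    using q(1) by unfold_locales auto
  interpret conjugation_algebra "residue_ring (int q)" "A_alg q t"
    using q1 by (rule conjugation_algebra_A_alg)
  have "odd (2 * n + 2 ^ t - 1)"
    using t(1) by simp
  then have "\<not> d dvd 2 * n + 2 ^ t - 1"
    using \<open>even d\<close> dvd_trans by blast
  then have "(S_number l t * int (l_number l (2 * n + 2 ^ t - 1))) mod int q \<noteq> 0"
    by (simp add: S_number_mult_mod_eq_0_iff[OF t(2)] dvd_l_number_iff[OF q])
  then show ?thesis
    using Units_of_norm[OF R.is_field l_element_closed[OF q1] _ _ l_element_norm[OF q1 t(1)]]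
    by (simp add: R.res_zero_eq)
qed

text \<open>
  An idempotent \<open>P\<^sub>n\<close> would have norm \<open>0\<close>, so \<open>d\<close> would divide \<open>2 n + 2\<^sup>t - 1\<close>, hence \<open>2 n\<close>, and, being odd,
  also \<open>n\<close>; but then its trace \<open>2 p\<^sub>n\<close> would be \<open>0\<close> and not \<open>1\<close>.
\<close>

lemma l_element_not_idempotent:
  assumes q: "prime q" "d = (LEAST m. 0 < m \<and> q dvd l_number l m)"
    and t: "t \<ge> 1" "gcd (int q) (S_number l t) = 1" and d: "odd d" "d dvd 2 ^ t - 1"
  shows "\<not> idempotent_element (A_alg q t) (l_element l q t n)"
proof
  assume idem: "idempotent_element (A_alg q t) (l_element l q t n)"
  have q1: "q > 1" using q(1) prime_gt_1_nat by blast
  interpret R: residues_prime q "residue_ring (int q)"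
    using q(1) by unfold_locales auto
  interpret conjugation_algebra "residue_ring (int q)" "A_alg q t"
    using q1 by (rule conjugation_algebra_A_alg)
  have "(2 * int (l_number l n)) mod int q = 1 \<and>
      (S_number l t * int (l_number l (2 * n + 2 ^ t - 1))) mod int q = 0"
    using idempotent_trace_norm[OF R.is_field l_element_closed[OF q1] _ _
        l_element_trace[OF q1] l_element_norm(1)[OF q1 t(1)] idem]
    by (simp add: R.res_zero_eq R.res_one_eq)
  then have trace: "(2 * int (l_number l n)) mod int q = 1"
    and "d dvd 2 * n + 2 ^ t - 1"
    by (simp_all add: S_number_mult_mod_eq_0_iff[OF t(2)] dvd_l_number_iff[OF q])
  moreover have "2 * n + 2 ^ t - 1 = 2 * n + (2 ^ t - 1)"
    by simp
  ultimately have "d dvd 2 * n"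
    using d(2) dvd_add_left_iff by metis
  then have "d dvd n"
    using d(1) by (simp add: coprime_dvd_mult_right_iff)
  then have "q dvd l_number l n"
    by (simp add: dvd_l_number_iff[OF q])
  then have "(2 * int (l_number l n)) mod int q = 0"
    by simp
  with trace show False by simp
qed

theorem theorem3p2:
  fixes l q d :: nat
  assumes "l \<ge> 1"
    and "prime q"
    and "d = (LEAST m. 0 < m \<and> q dvd l_number l m)"
  shows "(\<forall>n. q dvd l_number l n \<longleftrightarrow> d dvd n) \<and>
    (\<forall>t. odd q \<and> t \<ge> 2 \<and> gcd (int q) (S_number l t) = 1 \<and> even d \<longrightarrow>
      (\<forall>n\<ge>d. l_element l q t n \<in> Units (A_alg q t))) \<and>
    (\<forall>t. odd q \<and> t \<in> {2, 3} \<and> gcd (int q) (S_number l t) = 1 \<and> odd d \<and> d dvd 2 ^ t - 1 \<longrightarrow>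
      (\<forall>n. \<not> idempotent_element (A_alg q t) (l_element l q t n)))"
proof (intro conjI allI impI)
  show "q dvd l_number l n \<longleftrightarrow> d dvd n" for n
    using assms(2,3) by (rule dvd_l_number_iff)
next
  fix t n
  assume "odd q \<and> t \<ge> 2 \<and> gcd (int q) (S_number l t) = 1 \<and> even d"
  then show "l_element l q t n \<in> Units (A_alg q t)"
    by (intro l_element_Units[OF assms(2,3)]) auto
next
  fix t n
  assume "odd q \<and> t \<in> {2, 3} \<and> gcd (int q) (S_number l t) = 1 \<and> odd d \<and> d dvd 2 ^ t - 1"
  then show "\<not> idempotent_element (A_alg q t) (l_element l q t n)"
    by (intro l_element_not_idempotent[OF assms(2,3)]) auto
qed

end
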